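(* Let $p\geq 5$ be a prime and let $s$ be any nonnegative integer. If $B$ is a positive integer such that $p\nmid B$ and $p^{2s+1}B\equiv 1\pmod{24}$, then $$DSOME\left(\frac{p^{2s+1}B-1}{24}\right)\equiv 0\pmod 2.$$
   Context: $DSOME(n)$ denotes the sum of all the odd parts in all the partitions of $n$ into distinct parts minus the sum of all the even parts in all those same partitions, with $DSOME(0)=0$. Equivalently, $\sum_{n\ge 0}DSOME(n)q^n=\prod_{j\ge1}(1+q^j)\cdot\sum_{m\ge 1}\frac{(-1)^{m-1}q^m}{(1+q^m)^2}$. *)

theory Defs
  imports "HOL-Number_Theory.Number_Theory"
begin

text \<open>A partition into distinct parts is encoded as the finite set of its parts.\<close>

definition distinct_partitions :: "nat \<Rightarrow> nat set set" where
  "distinct_partitions n = {P. finite P \<and> 0 \<notin> P \<and> \<Sum>P = n}"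

text \<open>The values are integers because the difference may be negative.\<close>

definition DSOME :: "nat \<Rightarrow> int" where
  "DSOME n =
     (\<Sum>P\<in>distinct_partitions n. \<Sum>k\<in>{k\<in>P. odd k}. int k)
   - (\<Sum>P\<in>distinct_partitions n. \<Sum>k\<in>{k\<in>P. even k}. int k)"

text \<open>Finiteness shows that the outer sums above are not vacuous.\<close>

lemma finite_distinct_partitions: "finite (distinct_partitions n)"
proof (rule finite_subset)
  show "distinct_partitions n \<subseteq> Pow {..n}"
    by (auto simp: distinct_partitions_def intro: member_le_sum[where f = "\<lambda>x. x"])
qed simp

lemma DSOME_0: "DSOME 0 = 0"
proof -
  have "distinct_partitions 0 = {{}}"
    by (auto simp: distinct_partitions_def)
  then show ?thesis by (simp add: DSOME_def)
qed

end

theory Submission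
  imports Defs "HOL-Computational_Algebra.Nth_Powers"
begin

text \<open>
  Modulo 2 the sign in DSOME is invisible, so DSOME of n has the parity of the sum of all parts
  of all partitions of n into distinct parts, which is n times the number of those partitions.
  That number is even unless 24 n + 1 is a perfect square: this is a consequence of Euler's
  pentagonal number theorem, and it is proved here by Franklin's pairing
  (\<open>bij_betw_base_onto_slope\<close>).  For the n of the theorem, 24 n + 1 is divisible by the prime p
  to exactly an odd power, so it is not a square.

  In a Ferrers diagram with distinct rows, the base is the smallest part \<open>Min P\<close>, and the slope
  is the longest run of consecutive integers that ends at \<open>Max P\<close>.  If the slope is at least as
  long as the base, Franklin removes the base and adds one cell to each of the \<open>Min P\<close> largest
  parts; otherwise he removes one cell from every part of the slope and makes a new smallest part
  from these cells.  The two moves undo each other.  They fail only when base and slope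
  overlap, which happens for the sets \<open>{a..<2 * a}\<close> and \<open>{a<..2 * a}\<close> alone, and the sums of these
  sets are generalized pentagonal numbers.
\<close>

section \<open>Franklin's two moves\<close>

definition slope_length :: "nat set \<Rightarrow> nat" where
  "slope_length P = (LEAST k. Max P - k \<notin> P)"

text \<open>
  Adding one cell to each part of a run \<open>{a..b}\<close> replaces it by \<open>{a + 1..b + 1}\<close>, so as a set it
  only loses a and gains b + 1.  This is why each move changes just three elements.
\<close>

definition base_onto_slope :: "nat set \<Rightarrow> nat set" where
  "base_onto_slope P = insert (Max P + 1) (P - {Min P, Max P + 1 - Min P})"

definition slope_onto_base :: "nat set \<Rightarrow> nat set" where
  "slope_onto_base P =
     insert (slope_length P) (insert (Max P - slope_length P) (P - {Max P}))"

definition base_fits_slope :: "nat set \<Rightarrow> bool" where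
  "base_fits_slope P \<longleftrightarrow> {Max P + 1 - Min P..Max P} \<subseteq> P"

lemma slope_length_eqI:
  assumes "\<And>k. k < l \<Longrightarrow> Max P - k \<in> P" and "Max P - l \<notin> P"
  shows "slope_length P = l"
  unfolding slope_length_def using assms by (intro Least_equality) (auto simp: not_less[symmetric])

text \<open>
  The run must stop because 0 is not a part: \<open>k = Max P\<close> always qualifies in the definition of
  \<open>slope_length\<close>.
\<close>

lemma below_slope_notin:
  assumes "0 \<notin> P"
  shows "Max P - slope_length P \<notin> P"
  unfolding slope_length_def using assms by (rule_tac LeastI[of _ "Max P"]) simp

lemma slope_subset:
  assumes "0 \<notin> P" "P \<noteq> {}" "finite P"
  shows "{Max P - slope_length P<..Max P} \<subseteq> P"
proof
  fix x assume x: "x \<in> {Max P - slope_length P<..Max P}"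
  then have "Max P - x < slope_length P" by auto
  then have "Max P - (Max P - x) \<in> P"
    unfolding slope_length_def using not_less_Least by blast
  then show "x \<in> P" using x by simp
qed

lemma slope_length_pos:
  assumes "P \<noteq> {}" "finite P" "0 \<notin> P"
  shows "0 < slope_length P"
  using below_slope_notin[OF assms(3)] Max_in[OF assms(2,1)] by (cases "slope_length P") auto

lemma slope_shorter_than_base:
  assumes "P \<noteq> {}" "finite P" "0 \<notin> P" "\<not> base_fits_slope P"
  shows "slope_length P < Min P"
proof (rule ccontr)
  assume "\<not> slope_length P < Min P"
  moreover have "0 < Min P" using assms Min_in by (metis gr0I)
  ultimately have "{Max P + 1 - Min P..Max P} \<subseteq> {Max P - slope_length P<..Max P}"
    using Min_le[OF assms(2) Max_in[OF assms(2,1)]] by auto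
  then show False using slope_subset assms unfolding base_fits_slope_def by blast
qed

section \<open>The partitions on which the moves fail\<close>

text \<open>
  The two families of sums are the generalized pentagonal numbers \<open>a * (3 * a + 1) / 2\<close> and
  \<open>a * (3 * a - 1) / 2\<close>; completing the square gives the squares below.
\<close>

lemma sum_greaterThanAtMost_double:
  "24 * \<Sum>{a<..2 * a :: nat} + 1 = (6 * a + 1)\<^sup>2"
proof (induction a)
  case (Suc a)
  have "insert (Suc a) {Suc a<..2 * Suc a} = insert (2 * a + 1) (insert (2 * a + 2) {a<..2 * a})"
    by auto
  then have "\<Sum>(insert (Suc a) {Suc a<..2 * Suc a})
      = \<Sum>(insert (2 * a + 1) (insert (2 * a + 2) {a<..2 * a}))"
    by (rule arg_cong)
  then have "Suc a + \<Sum>{Suc a<..2 * Suc a} = 4 * a + 3 + \<Sum>{a<..2 * a}"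
    by simp
  then have "\<Sum>{Suc a<..2 * Suc a} = 3 * a + 2 + \<Sum>{a<..2 * a}"
    by simp
  then show ?case
    using Suc.IH by (simp add: power2_eq_square algebra_simps)
qed simp

lemma sum_atLeastLessThan_double:
  assumes "0 < a"
  shows "24 * \<Sum>{a..<2 * a :: nat} + 1 = (6 * a - 1)\<^sup>2"
proof -
  have "insert (2 * a) {a..<2 * a} = insert a {a<..2 * a}"
    using assms by auto
  then have "\<Sum>(insert (2 * a) {a..<2 * a}) = \<Sum>(insert a {a<..2 * a})"
    by (rule arg_cong)
  then have "\<Sum>{a..<2 * a} + a = \<Sum>{a<..2 * a}"
    by simp
  moreover have "(6 * a - 1)\<^sup>2 + 24 * a = (6 * a + 1)\<^sup>2"
    using assms by (cases a) (simp_all add: power2_eq_square algebra_simps)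
  ultimately show ?thesis
    using sum_greaterThanAtMost_double[of a] by linarith
qed

text \<open>
  The base lies in the run that would receive it exactly when \<open>2 * Min P = Max P + 1\<close>, and then
  this run is all of P.
\<close>

lemma base_apart_from_receiving_run:
  assumes P: "P \<in> distinct_partitions n" "P \<noteq> {}" "base_fits_slope P"
    and n: "\<not> is_square (24 * n + 1)"
  shows "Min P < Max P + 1 - Min P"
proof -
  have fin: "finite P" "0 \<notin> P" and sum: "\<Sum>P = n"
    using P(1) by (auto simp: distinct_partitions_def)
  have pos: "0 < Min P" using fin P(2) Min_in by (metis gr0I)
  have "Max P + 1 - Min P \<in> P"
    using P(3) pos Min_le[OF fin(1) Max_in[OF fin(1) P(2)]]
    unfolding base_fits_slope_def by auto
  then have "Min P \<le> Max P + 1 - Min P" using fin by simp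
  moreover have "Min P \<noteq> Max P + 1 - Min P"
  proof
    assume eq: "Min P = Max P + 1 - Min P"
    then have m: "Max P + 1 = 2 * Min P" using pos by auto
    have "P = {Min P..<2 * Min P}"
    proof
      show "P \<subseteq> {Min P..<2 * Min P}"
        using Min_le[OF fin(1)] Max_ge[OF fin(1)] m by fastforce
      show "{Min P..<2 * Min P} \<subseteq> P"
        using P(3) m unfolding base_fits_slope_def by fastforce
    qed
    then have "24 * n + 1 = (6 * Min P - 1)\<^sup>2"
      using sum_atLeastLessThan_double[OF pos] sum by metis
    then show False using n by (metis is_nth_power_nth_power)
  qed
  ultimately show ?thesis by simp
qed

text \<open>
  The cells taken from the slope form a part smaller than every part of the lowered slope, unless
  \<open>Max P = 2 * slope_length P\<close>; as all parts exceed \<open>slope_length P\<close>, the slope is then all of P.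
\<close>

lemma new_base_below_slope:
  assumes P: "P \<in> distinct_partitions n" "P \<noteq> {}" "\<not> base_fits_slope P"
    and n: "\<not> is_square (24 * n + 1)"
  shows "slope_length P < Max P - slope_length P"
proof -
  have fin: "finite P" "0 \<notin> P" and sum: "\<Sum>P = n"
    using P(1) by (auto simp: distinct_partitions_def)
  let ?l = "slope_length P"
  have lt: "?l < Min P" using slope_shorter_than_base P fin by blast
  have pos: "0 < ?l" using slope_length_pos P fin by blast
  have le: "Min P \<le> Max P" using fin P(2) by simp
  have sub: "{Max P - ?l<..Max P} \<subseteq> P" using slope_subset P(2) fin by blast
  then have "Max P - ?l + 1 \<in> P" using pos lt le by auto
  then have "Min P \<le> Max P - ?l + 1" using fin by simp
  then have "?l \<le> Max P - ?l" using lt by simp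
  moreover have "?l \<noteq> Max P - ?l"
  proof
    assume eq: "?l = Max P - ?l"
    then have m: "Max P = 2 * ?l" using lt le by auto
    have "P = {?l<..2 * ?l}"
    proof
      show "P \<subseteq> {?l<..2 * ?l}"
        using Min_le[OF fin(1)] Max_ge[OF fin(1)] m lt by fastforce
      show "{?l<..2 * ?l} \<subseteq> P"
        using sub m by simp
    qed
    then have "24 * n + 1 = (6 * ?l + 1)\<^sup>2"
      using sum_greaterThanAtMost_double[of ?l] sum by metis
    then show False using n by (metis is_nth_power_nth_power)
  qed
  ultimately show ?thesis by simp
qed

section \<open>Franklin's pairing\<close>

text \<open>
  The shifted run has \<open>Min P\<close> parts, and the number just below it has become free, so the new
  slope has length exactly \<open>Min P\<close>.  All remaining parts are larger than the removed base, hence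
  the new slope is shorter than the new base, and the inverse move takes back exactly the cells
  of the old base.
\<close>

lemma base_onto_slope_inverse:
  assumes P: "P \<in> distinct_partitions n" "P \<noteq> {}" "base_fits_slope P"
    and n: "\<not> is_square (24 * n + 1)"
  shows "base_onto_slope P \<in> distinct_partitions n" (is "?Q \<in> _")
    and "\<not> base_fits_slope (base_onto_slope P)"
    and "slope_onto_base (base_onto_slope P) = P"
proof -
  define m s where "m = Max P" and "s = Min P"
  have fin: "finite P" "0 \<notin> P" and sum: "\<Sum>P = n"
    using P(1) by (auto simp: distinct_partitions_def)
  have s: "s \<in> P" "\<And>x. x \<in> P \<Longrightarrow> s \<le> x" and m: "\<And>x. x \<in> P \<Longrightarrow> x \<le> m"
    using fin P(2) by (auto simp: s_def m_def)
  have pos: "0 < s" using s fin by (metis gr0I)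
  have apart: "s < m + 1 - s"
    using base_apart_from_receiving_run[OF P n] by (simp add: s_def m_def)
  have run: "{m + 1 - s..m} \<subseteq> P"
    using P(3) by (simp add: base_fits_slope_def s_def m_def)
  have Q: "?Q = insert (m + 1) (P - {s, m + 1 - s})"
    by (simp add: base_onto_slope_def s_def m_def)
  have new: "m + 1 \<notin> P" using m by fastforce
  have start: "m + 1 - s \<in> P" using run pos apart by auto
  have "\<Sum>P = s + \<Sum>(P - {s})" using fin s by (simp add: sum.remove)
  also have "\<Sum>(P - {s}) = (m + 1 - s) + \<Sum>(P - {s} - {m + 1 - s})"
    using fin start apart by (intro sum.remove) auto
  also have "P - {s} - {m + 1 - s} = P - {s, m + 1 - s}" by auto
  finally have "\<Sum>?Q = n" using sum fin new apart by (simp add: Q)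
  then show "?Q \<in> distinct_partitions n"
    using fin by (auto simp: distinct_partitions_def Q)
  have MaxQ: "Max ?Q = m + 1"
    unfolding Q using fin m by (intro Max_eqI) (auto simp: le_SucI)
  have len: "slope_length ?Q = s"
  proof (rule slope_length_eqI)
    fix k assume "k < s"
    then show "Max ?Q - k \<in> ?Q"
      using run apart unfolding MaxQ unfolding Q by (cases k) auto
  next
    show "Max ?Q - s \<notin> ?Q" unfolding MaxQ unfolding Q using pos apart by auto
  qed
  have "s < Min ?Q"
    unfolding Q using fin s apart by (subst Min_gr_iff) (auto simp: le_neq_implies_less)
  then have "m + 1 - s \<in> {Max ?Q + 1 - Min ?Q..Max ?Q}" unfolding MaxQ by auto
  moreover have "m + 1 - s \<notin> ?Q" using pos apart by (auto simp: Q)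
  ultimately show "\<not> base_fits_slope ?Q" unfolding base_fits_slope_def by blast
  show "slope_onto_base ?Q = P"
    unfolding slope_onto_base_def len MaxQ unfolding Q using s start new by auto
qed

text \<open>
  The new base equals the length of the old slope, and the old slope, shifted down by one, is
  still a run of that length ending at the new maximum.  So the new base fits on it, and putting
  it back restores P.
\<close>

lemma slope_onto_base_inverse:
  assumes P: "P \<in> distinct_partitions n" "P \<noteq> {}" "\<not> base_fits_slope P"
    and n: "\<not> is_square (24 * n + 1)"
  shows "slope_onto_base P \<in> distinct_partitions n" (is "?Q \<in> _")
    and "base_fits_slope (slope_onto_base P)"
    and "base_onto_slope (slope_onto_base P) = P"
proof -
  define m l where "m = Max P" and "l = slope_length P"
  have fin: "finite P" "0 \<notin> P" and sum: "\<Sum>P = n"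
    using P(1) by (auto simp: distinct_partitions_def)
  have m: "m \<in> P" "\<And>x. x \<in> P \<Longrightarrow> x \<le> m" using fin P(2) by (auto simp: m_def)
  have pos: "0 < l" using slope_length_pos P(2) fin by (simp add: l_def)
  have apart: "l < m - l"
    using new_base_below_slope[OF P n] by (simp add: l_def m_def)
  have l: "\<And>x. x \<in> P \<Longrightarrow> l < x"
    using slope_shorter_than_base[OF P(2) fin P(3)] Min_le[OF fin(1)]
    by (fastforce simp: l_def)
  have run: "{m - l<..m} \<subseteq> P"
    using slope_subset[OF fin(2) P(2) fin(1)] by (simp add: l_def m_def)
  have gap: "m - l \<notin> P" using below_slope_notin[OF fin(2)] by (simp add: l_def m_def)
  have Q: "?Q = insert l (insert (m - l) (P - {m}))"
    by (simp add: slope_onto_base_def l_def m_def)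
  have new: "l \<notin> P" using l by blast
  have "\<Sum>P = m + \<Sum>(P - {m})" using fin m by (simp add: sum.remove)
  then have "\<Sum>?Q = n" using sum fin new gap apart by (simp add: Q)
  then show "?Q \<in> distinct_partitions n"
    using fin pos apart by (auto simp: distinct_partitions_def Q)
  have "m - 1 \<in> ?Q"
  proof (cases "l = 1")
    case False
    then have "m - 1 \<in> {m - l<..m}" using pos apart by auto
    then show ?thesis using run apart by (auto simp: Q)
  qed (simp add: Q)
  moreover have "x \<le> m - 1" if "x \<in> ?Q" for x
    using that m(2)[of x] pos apart by (auto simp: Q)
  ultimately have MaxQ: "Max ?Q = m - 1"
    using fin by (intro Max_eqI) (auto simp: Q)
  have MinQ: "Min ?Q = l"
    unfolding Q using fin l apart by (intro Min_eqI) (auto simp: less_imp_le)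
  have start: "Max ?Q + 1 - Min ?Q = m - l" using apart by (simp add: MaxQ MinQ)
  have "x \<in> ?Q" if "m - l \<le> x" "x \<le> m - 1" for x
    using that run apart by (cases "x = m - l") (auto simp: Q)
  then show "base_fits_slope ?Q"
    unfolding base_fits_slope_def start unfolding MaxQ by auto
  have "Max ?Q + 1 = m" using apart by (simp add: MaxQ)
  then show "base_onto_slope ?Q = P"
    unfolding base_onto_slope_def start unfolding MinQ unfolding Q using m new gap by auto
qed

text \<open>
  The empty partition, which neither move covers, is excluded by the hypothesis as well:
  \<open>24 * 0 + 1\<close> is a square.
\<close>

lemma bij_betw_base_onto_slope:
  assumes "\<not> is_square (24 * n + 1)"
  shows "bij_betw base_onto_slope {P \<in> distinct_partitions n. base_fits_slope P}
           {P \<in> distinct_partitions n. \<not> base_fits_slope P}"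
proof -
  have "{} \<notin> distinct_partitions n"
    using assms by (cases "n = 0") (auto simp: distinct_partitions_def)
  then have ne: "P \<noteq> {}" if "P \<in> distinct_partitions n" for P
    using that by auto
  show ?thesis
    using base_onto_slope_inverse[OF _ ne _ assms] slope_onto_base_inverse[OF _ ne _ assms]
    by (intro bij_betw_byWitness[where f' = slope_onto_base]) auto
qed

lemma even_card_distinct_partitions:
  assumes "\<not> is_square (24 * n + 1)"
  shows "even (card (distinct_partitions n))"
proof -
  let ?A = "{P \<in> distinct_partitions n. base_fits_slope P}"
  let ?B = "{P \<in> distinct_partitions n. \<not> base_fits_slope P}"
  have "card (distinct_partitions n) = card (?A \<union> ?B)"
    by (rule arg_cong[where f = card]) auto
  also have "\<dots> = card ?A + card ?B"
    using finite_distinct_partitions by (intro card_Un_disjoint) auto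
  also have "card ?A = card ?B"
    using bij_betw_base_onto_slope[OF assms] by (rule bij_betw_same_card)
  finally show ?thesis by simp
qed

section \<open>The parity of DSOME\<close>

lemma even_DSOME_iff: "even (DSOME n) \<longleftrightarrow> even (n * card (distinct_partitions n))"
proof -
  have split: "(\<Sum>k\<in>{k\<in>P. odd k}. int k) + (\<Sum>k\<in>{k\<in>P. even k}. int k) = int n"
    if "P \<in> distinct_partitions n" for P
  proof -
    have P: "finite P" "\<Sum>P = n" using that by (auto simp: distinct_partitions_def)
    have "(\<Sum>k\<in>{k\<in>P. odd k}. int k) + (\<Sum>k\<in>{k\<in>P. even k}. int k)
        = (\<Sum>k\<in>{k\<in>P. odd k} \<union> {k\<in>P. even k}. int k)"
      using P by (intro sum.union_disjoint[symmetric]) auto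
    also have "{k\<in>P. odd k} \<union> {k\<in>P. even k} = P" by auto
    finally show ?thesis using P by (simp flip: of_nat_sum)
  qed
  have "even (DSOME n) \<longleftrightarrow>
      even ((\<Sum>P\<in>distinct_partitions n. \<Sum>k\<in>{k\<in>P. odd k}. int k)
          + (\<Sum>P\<in>distinct_partitions n. \<Sum>k\<in>{k\<in>P. even k}. int k))"
    unfolding DSOME_def by simp
  also have "\<dots> \<longleftrightarrow> even (\<Sum>P\<in>distinct_partitions n. int n)"
    by (simp only: sum.distrib[symmetric] split cong: sum.cong)
  finally show ?thesis by auto
qed

lemma even_DSOME:
  assumes "\<not> is_square (24 * n + 1)"
  shows "even (DSOME n)"
  using even_card_distinct_partitions[OF assms] by (simp add: even_DSOME_iff)

lemma not_square_odd_prime_power_mult: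
  fixes p B :: nat
  assumes "prime p" "\<not> p dvd B"
  shows "\<not> is_square (p ^ (2 * s + 1) * B)"
proof -
  have "coprime (p ^ (2 * s + 1)) B"
    using assms by (simp add: prime_imp_coprime del: power_Suc)
  then show ?thesis
    using assms(1)
    by (simp add: is_nth_power_mult_coprime_nat_iff is_nth_power_prime_power_nat_iff
          del: power_Suc)
qed

theorem corollary4p4:
  fixes p s B :: nat
  assumes "prime p" and "p \<ge> 5"
    and "B > 0" and "\<not> p dvd B"
    and "[p ^ (2 * s + 1) * B = 1] (mod 24)"
  shows "[DSOME ((p ^ (2 * s + 1) * B - 1) div 24) = 0] (mod 2)"
proof -
  have "(p ^ (2 * s + 1) * B) mod 24 = 1" using assms(5) by (simp add: cong_def)
  then obtain n where n: "p ^ (2 * s + 1) * B = 24 * n + 1"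
    by (metis mult_div_mod_eq)
  have "\<not> is_square (24 * n + 1)"
    unfolding n[symmetric] using assms(1,4) by (rule not_square_odd_prime_power_mult)
  then have "even (DSOME n)" by (rule even_DSOME)
  then show ?thesis unfolding n by (simp add: cong_0_iff)
qed

end
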